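(* Let $n\ge 1$ and let $R$ be a ring with $1$ satisfying the polynomial identity $[x,y][u,v]=0$, i.e. $(xy-yx)(uv-vu)=0$ for all $x,y,u,v\in R$. Let $A\in\mathrm{M}_n(R)$ and let $p(x)=\mathrm{sdet}(xI-A)=\lambda_0+\lambda_1x+\cdots+\lambda_{n-1}x^{n-1}+\lambda_nx^n\in R[x]$ (with $\lambda_n=n!$) be the symmetric characteristic polynomial of $A$. Put $c_{i,j}=\lambda_i\lambda_j\in R$ for $0\le i,j\le n$. Then $$\sum_{0\le i,j\le n}A^i c_{i,j}A^j=0,$$ and this identity is invariant: for every $T\in\mathrm{GL}_n(\mathrm{Z}(R))$, where $\mathrm{Z}(R)$ is the centre of $R$, the coefficients $c_{i,j}$ ($0\le i,j\le n$) obtained in this way from $TAT^{-1}$ coincide with those obtained from $A$.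
   Context: Rings are associative with $1$ and not necessarily commutative; $[x,y]=xy-yx$. $I$ is the unit matrix, $A^0=I$, and for $c\in R$ the expression $A^icA^j$ means $A^i(cI)A^j$. For any ring $S$ with $1$ and a matrix $B=[b_{i,j}]\in\mathrm{M}_n(S)$, the preadjoint of $B$ is the matrix $B^{\ast}=[b^{\ast}_{r,s}]\in\mathrm{M}_n(S)$ with $$b^{\ast}_{r,s}=\sum_{\tau,\rho}\mathrm{sgn}(\rho)\,b_{\tau(1),\rho(\tau(1))}\cdots b_{\tau(s-1),\rho(\tau(s-1))}\,b_{\tau(s+1),\rho(\tau(s+1))}\cdots b_{\tau(n),\rho(\tau(n))},$$ where the sum is over all permutations $\tau,\rho\in\mathrm{S}_n$ of $\{1,\ldots,n\}$ with $\tau(s)=s$ and $\rho(s)=r$ (the factors are multiplied in the displayed order, the factor with index $s$ being omitted; an empty product is $1$). The symmetric determinant of $B$ is $\mathrm{sdet}(B)=\mathrm{tr}(B^{\ast}B)=\mathrm{tr}(BB^{\ast})$, where $\mathrm{tr}$ is the sum of the diagonal entries (the two traces are equal). $R[x]$ denotes the ring of polynomials over $R$ in a single indeterminate $x$ commuting with the elements of $R$. The symmetric characteristic polynomial of $A\in\mathrm{M}_n(R)$ is $p(x)=\mathrm{sdet}(xI-A)\in R[x]$, the symmetric determinant of the matrix $xI-A\in\mathrm{M}_n(R[x])$; it has degree at most $n$ and its coefficient of $x^n$ is $n!$. *)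

theory Defs
  imports
    "HOL-Library.Poly_Mapping"
    "HOL-Combinatorics.Permutations"
    "Jordan_Normal_Form.Matrix"
begin

text \<open>Matrices of size n are elements of \<^term>\<open>carrier_mat n n\<close>; rows and columns are numbered
  from 0, so that the index set is \<open>{0..<n}\<close>. The operations on these matrices are available over
  noncommutative rings.\<close>

definition ring_centre :: "'a::ring_1 set" where
  "ring_centre = {z. \<forall>x. z * x = x * z}"

text \<open>In \<open>GL_mat n C\<close> the inverse is required to have its entries in C as well, i.e. the matrix is a
  unit of the ring of n by n matrices over the subring C.\<close>

definition GL_mat :: "nat \<Rightarrow> 'a::ring_1 set \<Rightarrow> 'a mat set" where
  "GL_mat n C = {T \<in> carrier_mat n n. elements_mat T \<subseteq> C \<and>
     (\<exists>S \<in> carrier_mat n n. elements_mat S \<subseteq> C \<and> inverts_mat T S \<and> inverts_mat S T)}"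

definition mat_trace :: "'a::comm_monoid_add mat \<Rightarrow> 'a" where
  "mat_trace B = (\<Sum>i = 0..<dim_row B. B $$ (i, i))"

text \<open>The order of the factors matters, hence a product over a list: t runs through the indices in
  increasing order with s left out.\<close>

definition preadjoint :: "'a::ring_1 mat \<Rightarrow> 'a mat" where
  "preadjoint B = (let n = dim_row B in mat n n (\<lambda>(r, s).
     \<Sum>\<tau> | \<tau> permutes {0..<n} \<and> \<tau> s = s.
     \<Sum>\<rho> | \<rho> permutes {0..<n} \<and> \<rho> s = r.
       of_int (sign \<rho>) * (\<Prod>t\<leftarrow>filter (\<lambda>t. t \<noteq> s) [0..<n]. B $$ (\<tau> t, \<rho> (\<tau> t)))))"

definition sdet :: "'a::ring_1 mat \<Rightarrow> 'a" where
  "sdet B = mat_trace (preadjoint B * B)"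

text \<open>The library type of polynomials is a ring only over commutative coefficients. Over an arbitrary
  ring, the polynomial ring in one central indeterminate is the monoid ring of the natural numbers,
  i.e. the finitely supported coefficient sequences with convolution as multiplication; the
  coefficient of the i-th power of the indeterminate in p is \<open>Poly_Mapping.lookup p i\<close>.\<close>

type_synonym 'a ncpoly = "nat \<Rightarrow>\<^sub>0 'a"

definition poly_X :: "'a::ring_1 ncpoly" where
  "poly_X = Poly_Mapping.single 1 1"

definition poly_C :: "'a::ring_1 \<Rightarrow> 'a ncpoly" where
  "poly_C a = Poly_Mapping.single 0 a"

definition sym_char_poly :: "'a::ring_1 mat \<Rightarrow> 'a ncpoly" where
  "sym_char_poly A = sdet (poly_X \<cdot>\<^sub>m 1\<^sub>m (dim_row A) - map_mat poly_C A)"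

definition sym_char_coeff :: "'a::ring_1 mat \<Rightarrow> nat \<Rightarrow> 'a" where
  "sym_char_coeff A i = Poly_Mapping.lookup (sym_char_poly A) i"

definition sym_char_coeff2 :: "'a::ring_1 mat \<Rightarrow> nat \<Rightarrow> nat \<Rightarrow> 'a" where
  "sym_char_coeff2 A i j = sym_char_coeff A i * sym_char_coeff A j"

end

theory Submission
  imports
    Defs
    "Jordan_Normal_Form.Char_Poly"
    "HOL-Combinatorics.Multiset_Permutations"
begin

text \<open>Let D be the ideal generated by the commutators. The identity \<open>[x, y] [u, v] = 0\<close> forces
  \<open>D * D = 0\<close> (\<open>comm_ideal_square_zero\<close>), because a factor between two commutators can be absorbed into
  commutators. The double sum of the theorem is the product of the matrices
  \<open>\<Sum>i. A ^ i \<lambda>_i\<close> and \<open>\<Sum>j. \<lambda>_j A ^ j\<close>, so it is enough that both have all their entries in D. This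
  is a statement about the image of A over the commutative ring \<open>R / D\<close>. There the symmetric
  determinant is \<open>fact n\<close> times the determinant (\<open>sdet_commutative\<close>), hence the symmetric characteristic
  polynomial is \<open>fact n\<close> times the ordinary one, and both sums vanish by the theorem of Cayley and
  Hamilton (\<open>cayley_hamilton_entry\<close>).

  The remaining claims rest on one formula for the symmetric determinant
  (\<open>sdet_eq_sum_row_det\<close>): it is the sum, over all orders of the rows, of the Leibniz expansion with
  its factors multiplied in that order. For a fixed order, the coefficient of \<open>x ^ n\<close> in the expansion
  of \<open>sdet (x I - A)\<close> is 1, and there are \<open>fact n\<close> orders. Entries of a central matrix can be pulled out
  of each ordered product, so multiplication by such a matrix, on either side, multiplies the
  symmetric determinant by the determinant of that matrix, just as in the commutative case. Thus
  \<open>sdet (T B S) = sdet B\<close> when T and S are central and inverse to each other (\<open>sdet_conjugate\<close>). For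
  \<open>B = x I - A\<close> this shows that even the coefficients \<open>\<lambda>_i\<close> themselves, and not only their
  products, are invariant.

  The centre and the abelianization are introduced as types, so that the determinants of matrices
  over these rings are the usual ones.\<close>

section \<open>The centre as a commutative ring\<close>

lemma ring_centre_closed:
  fixes x y :: "'a::ring_1"
  shows "0 \<in> (ring_centre :: 'a set)" "1 \<in> (ring_centre :: 'a set)"
    and "x \<in> ring_centre \<Longrightarrow> - x \<in> ring_centre"
    and "x \<in> ring_centre \<Longrightarrow> y \<in> ring_centre \<Longrightarrow> x + y \<in> ring_centre"
    and "x \<in> ring_centre \<Longrightarrow> y \<in> ring_centre \<Longrightarrow> x - y \<in> ring_centre"
    and "x \<in> ring_centre \<Longrightarrow> y \<in> ring_centre \<Longrightarrow> x * y \<in> ring_centre"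
proof -
  have comm: "c * z = z * c" if "c \<in> ring_centre" for c z :: 'a
    using that unfolding ring_centre_def by blast
  show "0 \<in> (ring_centre :: 'a set)" "1 \<in> (ring_centre :: 'a set)"
    by (simp_all add: ring_centre_def)
  show "- x \<in> ring_centre" if "x \<in> ring_centre"
    unfolding ring_centre_def by (simp add: comm[OF that])
  assume x: "x \<in> ring_centre" and y: "y \<in> ring_centre"
  show "x + y \<in> ring_centre" "x - y \<in> ring_centre"
    unfolding ring_centre_def mem_Collect_eq distrib_left distrib_right
      left_diff_distrib right_diff_distrib
    using comm[OF x] comm[OF y] by metis+
  have "x * y * z = z * (x * y)" for z
    using comm[OF x, of z] comm[OF y, of z] by (metis mult.assoc)
  then show "x * y \<in> ring_centre"
    unfolding ring_centre_def by blast
qed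

text \<open>As a type of its own the centre is an instance of \<^class>\<open>comm_ring_1\<close>, which makes determinants
  and their multiplicativity available for matrices with central entries.\<close>

typedef (overloaded) 'a centre = "ring_centre :: 'a::ring_1 set"
  morphisms centre_rep centre_abs
  by (rule exI[of _ 0]) (simp add: ring_centre_def)

setup_lifting type_definition_centre

lemma centre_rep_commute: "centre_rep z * x = x * centre_rep z"
  using centre_rep[of z] unfolding ring_centre_def by blast

instantiation centre :: (ring_1) comm_ring_1
begin

lift_definition zero_centre :: "'a centre" is 0
  by (rule ring_centre_closed)

lift_definition one_centre :: "'a centre" is 1
  by (rule ring_centre_closed)

lift_definition plus_centre :: "'a centre \<Rightarrow> 'a centre \<Rightarrow> 'a centre" is "(+)"
  by (rule ring_centre_closed)

lift_definition minus_centre :: "'a centre \<Rightarrow> 'a centre \<Rightarrow> 'a centre" is "(-)"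
  by (rule ring_centre_closed)

lift_definition uminus_centre :: "'a centre \<Rightarrow> 'a centre" is uminus
  by (rule ring_centre_closed)

lift_definition times_centre :: "'a centre \<Rightarrow> 'a centre \<Rightarrow> 'a centre" is "(*)"
  by (rule ring_centre_closed)

instance
proof
  fix a b c :: "'a centre"
  show "a * b = b * a"
    by transfer (unfold ring_centre_def, blast)
qed (transfer; simp add: algebra_simps)+

end

interpretation centre_rep: ring_hom "centre_rep :: 'a::ring_1 centre \<Rightarrow> 'a"
  by unfold_locales (transfer, simp)+

lemma mat_over_centre:
  assumes "elements_mat T \<subseteq> ring_centre" and "T \<in> carrier_mat n n"
  shows "map_mat centre_rep (map_mat centre_abs T) = T"
proof (rule eq_matI)
  fix i j assume "i < dim_row T" "j < dim_col T"
  moreover from this have "T $$ (i, j) \<in> ring_centre"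
    using assms(1) by (auto intro: elements_matI[of T])
  ultimately show "map_mat centre_rep (map_mat centre_abs T) $$ (i, j) = T $$ (i, j)"
    by (simp add: centre_abs_inverse)
qed auto

section \<open>The ideal generated by the commutators\<close>

inductive_set comm_ideal :: "'a::ring_1 set" where
  comm: "x * y - y * x \<in> comm_ideal"
| diff: "c \<in> comm_ideal \<Longrightarrow> d \<in> comm_ideal \<Longrightarrow> c - d \<in> comm_ideal"
| left: "c \<in> comm_ideal \<Longrightarrow> r * c \<in> comm_ideal"
| right: "c \<in> comm_ideal \<Longrightarrow> c * r \<in> comm_ideal"

text \<open>The factor r between two commutators is absorbed by
  \<open>r [u, v] = [r u, v] - [r, v] u\<close>: both terms on the right start with a commutator up to a right
  multiple, so the identity already gives \<open>[x, y] r [u, v] = 0\<close>. The two inductions then extend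
  this from commutators to the ideal, one factor at a time.\<close>

lemma comm_ideal_square_zero:
  fixes c d :: "'a::ring_1"
  assumes id: "\<And>x y u v :: 'a. (x * y - y * x) * (u * v - v * u) = 0"
    and "c \<in> comm_ideal" "d \<in> comm_ideal"
  shows "c * d = 0"
proof -
  have comm_mid: "(x * y - y * x) * r * (u * v - v * u) = 0" for x y r u v :: 'a
  proof -
    have "(x * y - y * x) * r * (u * v - v * u)
        = (x * y - y * x) * ((r * u) * v - v * (r * u)) - ((x * y - y * x) * (r * v - v * r)) * u"
      by (simp add: algebra_simps)
    also have "\<dots> = 0"
      using id[of x y "r * u" v] id[of x y r v] by simp
    finally show ?thesis .
  qed
  from assms(2) have half: "c * r * (u * v - v * u) = 0" for r u v
  proof (induction arbitrary: r)
    case (comm x y)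
    show ?case by (rule comm_mid)
  next
    case (diff c d)
    from diff.IH[of r] show ?case by (simp add: left_diff_distrib)
  next
    case (left c s)
    from left.IH[of r] show ?case by (simp add: mult.assoc)
  next
    case (right c s)
    from right.IH[of "s * r"] show ?case by (simp add: mult.assoc)
  qed
  from assms(3) have "c * r * d = 0" for r
  proof (induction arbitrary: r)
    case (comm u v)
    show ?case by (rule half)
  next
    case (diff d e)
    from diff.IH[of r] show ?case by (simp add: right_diff_distrib)
  next
    case (left d s)
    from left.IH[of "r * s"] show ?case by (simp add: mult.assoc)
  next
    case (right d s)
    from right.IH[of r] show ?case by (simp flip: mult.assoc)
  qed
  from this[of 1] show ?thesis by simp
qed

text \<open>The quotient of the ring by its commutator ideal is the zero ring when the ideal contains 1
  (rings of 2 by 2 matrices are examples), and the zero ring is no instance of \<^class>\<open>comm_ring_1\<close>. To have a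
  commutative ring for every \<^class>\<open>ring_1\<close>, the quotient is formed as \<open>ab_dom / ab_ker\<close>, which is the
  centre in that degenerate case and the abelianization otherwise.\<close>

definition ab_dom :: "'a::ring_1 set" where
  "ab_dom = (if 1 \<in> (comm_ideal :: 'a set) then ring_centre else UNIV)"

definition ab_ker :: "'a::ring_1 set" where
  "ab_ker = (if 1 \<in> (comm_ideal :: 'a set) then {0} else comm_ideal)"

lemma ab_dom_closed:
  fixes x y :: "'a::ring_1"
  shows "0 \<in> (ab_dom :: 'a set)" "1 \<in> (ab_dom :: 'a set)"
  "x \<in> ab_dom \<Longrightarrow> y \<in> ab_dom \<Longrightarrow> x + y \<in> ab_dom"
  "x \<in> ab_dom \<Longrightarrow> y \<in> ab_dom \<Longrightarrow> x - y \<in> ab_dom"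
  "x \<in> ab_dom \<Longrightarrow> - x \<in> ab_dom"
  "x \<in> ab_dom \<Longrightarrow> y \<in> ab_dom \<Longrightarrow> x * y \<in> ab_dom"
  by (auto simp: ab_dom_def intro: ring_centre_closed)

lemma comm_ideal_zero: "0 \<in> comm_ideal"
  using comm_ideal.comm[of 0 0] by simp

lemma ab_ker_closed:
  fixes x y c d r :: "'a::ring_1"
  shows "0 \<in> (ab_ker :: 'a set)" "1 \<notin> (ab_ker :: 'a set)"
  "c \<in> ab_ker \<Longrightarrow> d \<in> ab_ker \<Longrightarrow> c - d \<in> ab_ker"
  "c \<in> ab_ker \<Longrightarrow> r * c \<in> ab_ker"
  "c \<in> ab_ker \<Longrightarrow> c * r \<in> ab_ker"
  "x \<in> ab_dom \<Longrightarrow> y \<in> ab_dom \<Longrightarrow> x * y - y * x \<in> ab_ker"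
proof -
  show "x * y - y * x \<in> ab_ker" if "x \<in> ab_dom" "y \<in> ab_dom"
  proof (cases "1 \<in> (comm_ideal :: 'a set)")
    case True
    with that have "x \<in> ring_centre"
      by (simp add: ab_dom_def)
    then have "x * y = y * x"
      unfolding ring_centre_def by blast
    then show ?thesis by (simp add: ab_ker_def comm_ideal_zero)
  qed (simp add: ab_ker_def comm_ideal.comm)
qed (simp_all add: ab_ker_def comm_ideal_zero comm_ideal.diff comm_ideal.left comm_ideal.right
      split: if_splits)

lemma ab_ker_uminus: "c \<in> ab_ker \<Longrightarrow> - c \<in> ab_ker"
  using ab_ker_closed(3)[OF ab_ker_closed(1), of c] by simp

lemma ab_ker_add: "c \<in> ab_ker \<Longrightarrow> d \<in> ab_ker \<Longrightarrow> c + d \<in> ab_ker"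
  using ab_ker_closed(3)[of c "- d"] ab_ker_uminus[of d] by simp

definition ab_rel :: "'a::ring_1 \<Rightarrow> 'a \<Rightarrow> bool" where
  "ab_rel x y \<longleftrightarrow> x \<in> ab_dom \<and> y \<in> ab_dom \<and> x - y \<in> ab_ker"

lemma ab_rel_sym: "ab_rel x y \<Longrightarrow> ab_rel y x"
  using ab_ker_uminus[of "x - y"] by (auto simp: ab_rel_def)

lemma ab_rel_trans: "ab_rel x y \<Longrightarrow> ab_rel y z \<Longrightarrow> ab_rel x z"
  using ab_ker_add[of "x - y" "y - z"] by (auto simp: ab_rel_def)

quotient_type (overloaded) 'a ab = "'a::ring_1" / partial: ab_rel
proof (rule part_equivpI)
  show "\<exists>x::'a. ab_rel x x"
    by (rule exI[of _ 0]) (simp add: ab_rel_def ab_dom_closed ab_ker_closed)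
  show "symp (ab_rel :: 'a \<Rightarrow> 'a \<Rightarrow> bool)"
    by (rule sympI) (rule ab_rel_sym)
  show "transp (ab_rel :: 'a \<Rightarrow> 'a \<Rightarrow> bool)"
    by (rule transpI) (rule ab_rel_trans)
qed

lemma ab_rel_self: "ab_rel x x \<longleftrightarrow> x \<in> ab_dom"
  by (simp add: ab_rel_def ab_ker_closed)

lemma ab_rel_arith:
  assumes "ab_rel x x'" "ab_rel y y'"
  shows "ab_rel (x + y) (x' + y')" "ab_rel (x - y) (x' - y')" "ab_rel (x * y) (x' * y')"
proof -
  have dom: "x \<in> ab_dom" "x' \<in> ab_dom" "y \<in> ab_dom" "y' \<in> ab_dom"
    and ker: "x - x' \<in> ab_ker" "y - y' \<in> ab_ker"
    using assms by (auto simp: ab_rel_def)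
  have "(x + y) - (x' + y') = (x - x') + (y - y')"
    "(x - y) - (x' - y') = (x - x') - (y - y')"
    "x * y - x' * y' = (x - x') * y + x' * (y - y')"
    by (simp_all add: algebra_simps)
  moreover have "(x - x') + (y - y') \<in> ab_ker" "(x - x') - (y - y') \<in> ab_ker"
    "(x - x') * y + x' * (y - y') \<in> ab_ker"
    by (intro ab_ker_add ab_ker_closed(3-5) ker)+
  ultimately show "ab_rel (x + y) (x' + y')" "ab_rel (x - y) (x' - y')" "ab_rel (x * y) (x' * y')"
    using dom by (simp_all only: ab_rel_def ab_dom_closed simp_thms)
qed

instantiation ab :: (ring_1) comm_ring_1
begin

lift_definition zero_ab :: "'a ab" is 0
  by (simp add: ab_rel_self ab_dom_closed)

lift_definition one_ab :: "'a ab" is 1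
  by (simp add: ab_rel_self ab_dom_closed)

lift_definition plus_ab :: "'a ab \<Rightarrow> 'a ab \<Rightarrow> 'a ab" is "(+)"
  by (rule ab_rel_arith)

lift_definition minus_ab :: "'a ab \<Rightarrow> 'a ab \<Rightarrow> 'a ab" is "(-)"
  by (rule ab_rel_arith)

lift_definition uminus_ab :: "'a ab \<Rightarrow> 'a ab" is uminus
  using ab_rel_arith(2)[OF ab_rel_self[THEN iffD2, OF ab_dom_closed(1)]] by (simp only: diff_0)

lift_definition times_ab :: "'a ab \<Rightarrow> 'a ab \<Rightarrow> 'a ab" is "(*)"
  by (rule ab_rel_arith)

instance
proof
  fix a b c :: "'a ab"
  show "a * b = b * a"
    by transfer (simp add: ab_rel_self ab_rel_def ab_dom_closed ab_ker_closed)
  show "0 \<noteq> (1 :: 'a ab)"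
    by transfer (use ab_ker_closed(2) ab_ker_uminus[of "- 1"] in \<open>auto simp: ab_rel_def\<close>)
qed (transfer; simp add: ab_rel_self ab_dom_closed algebra_simps)+

end

lemma abs_ab_hom:
  assumes "1 \<notin> (comm_ideal :: 'a::ring_1 set)"
  shows "Ring_Hom.ring_hom (abs_ab :: 'a \<Rightarrow> 'a ab)"
    and "abs_ab (x :: 'a) = 0 \<longleftrightarrow> x \<in> comm_ideal"
proof -
  have dom: "ab_rel x x" for x :: 'a
    using assms by (simp add: ab_rel_self ab_dom_def)
  show "Ring_Hom.ring_hom (abs_ab :: 'a \<Rightarrow> 'a ab)"
    by unfold_locales
      (simp_all add: zero_ab.abs_eq one_ab.abs_eq plus_ab.abs_eq times_ab.abs_eq dom)
  show "abs_ab x = 0 \<longleftrightarrow> x \<in> comm_ideal"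
    using Quotient3_rel[OF Quotient3_ab, of x 0] dom assms
    by (simp add: zero_ab_def ab_rel_def ab_dom_def ab_ker_def)
qed

section \<open>The symmetric determinant as a sum over orderings\<close>

text \<open>The order in which one summand of the trace of \<open>preadjoint B * B\<close> runs through the rows of B:
  the entry of the preadjoint omits row s, and the right factor B supplies it at the end.\<close>

definition rows_ending_in :: "nat \<Rightarrow> nat \<Rightarrow> (nat \<Rightarrow> nat) \<Rightarrow> nat list" where
  "rows_ending_in n s \<tau> = map \<tau> (filter (\<lambda>t. t \<noteq> s) [0..<n]) @ [s]"

text \<open>A row order is determined by its last row s and by the way in which the remaining positions are
  filled, and a permutation fixing s describes the latter. Injectivity is direct; surjectivity
  follows by counting, as \<open>n * fact (n - 1) = fact n\<close>. For \<open>n = 0\<close> the empty row order has no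
  last row.\<close>

lemma bij_betw_rows_ending_in:
  assumes n: "0 < n"
  shows "bij_betw (\<lambda>(s, \<tau>). rows_ending_in n s \<tau>)
     (SIGMA s:{0..<n}. {\<tau>. \<tau> permutes {0..<n} \<and> \<tau> s = s}) (permutations_of_set {0..<n})"
    (is "bij_betw ?f ?D ?P")
proof (rule bij_betw_imageI)
  have fix_iff: "{\<tau>. \<tau> permutes {0..<n} \<and> \<tau> s = s} = {\<tau>. \<tau> permutes ({0..<n} - {s})}" for s
    by (auto intro: permutes_superset permutes_subset simp: permutes_not_in)
  show inj: "inj_on ?f ?D"
  proof (rule inj_onI, clarsimp)
    fix s \<tau> s' \<tau>'
    assume \<tau>: "\<tau> permutes {0..<n}" "\<tau> s = s" and \<tau>': "\<tau>' permutes {0..<n}" "\<tau>' s' = s'"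
      and eq: "rows_ending_in n s \<tau> = rows_ending_in n s' \<tau>'"
    from eq have s: "s = s'"
      by (simp add: rows_ending_in_def)
    with eq have "\<tau> t = \<tau>' t" if "t < n" "t \<noteq> s" for t
      using that by (auto simp: rows_ending_in_def)
    with s \<tau> \<tau>' have "\<tau> = \<tau>'"
      by (metis atLeastLessThan_iff ext permutes_not_in)
    with s show "s = s' \<and> \<tau> = \<tau>'" by simp
  qed
  show "?f ` ?D = ?P"
  proof (rule card_subset_eq)
    show "?f ` ?D \<subseteq> ?P"
    proof clarsimp
      fix s \<tau>
      assume "s < n" and \<tau>: "\<tau> permutes {0..<n}" "\<tau> s = s"
      have "\<tau> ` ({0..<n} - {s}) = {0..<n} - {s}"
        using \<tau> fix_iff[of s] by (intro permutes_image) auto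
      moreover have "set (filter (\<lambda>t. t \<noteq> s) [0..<n]) = {0..<n} - {s}"
        by auto
      ultimately show "rows_ending_in n s \<tau> \<in> permutations_of_set {0..<n}"
        using \<open>s < n\<close> permutes_inj_on[OF \<tau>(1)]
        by (auto simp: rows_ending_in_def permutations_of_set_def distinct_map)
    qed
    have "card (?f ` ?D) = (\<Sum>s\<in>{0..<n}. card {\<tau>. \<tau> permutes {0..<n} \<and> \<tau> s = s})"
      using inj by (simp add: card_image finite_permutations)
    also have "\<dots> = (\<Sum>s\<in>{0..<n}. fact (n - 1))"
      unfolding fix_iff by (rule sum.cong) (auto intro: card_permutations)
    also have "\<dots> = card ?P"
      using n by (simp add: fact_reduce)
    finally show "card (?f ` ?D) = card ?P" .
  qed simp
qed

text \<open>The Leibniz expansion of the determinant with the factors of every product taken in the row order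
  xs.\<close>

definition row_det :: "nat list \<Rightarrow> 'a::ring_1 mat \<Rightarrow> 'a" where
  "row_det xs B = (\<Sum>\<rho> | \<rho> permutes {0..<dim_row B}.
     of_int (sign \<rho>) * (\<Prod>i\<leftarrow>xs. B $$ (i, \<rho> i)))"

text \<open>This is the symmetric form of the symmetric determinant: the row omitted by the preadjoint and the
  final factor from B combine to a full row order, and every row order arises once. All further
  properties are read off from it.\<close>

theorem sdet_eq_sum_row_det:
  assumes n: "0 < n" and B: "B \<in> carrier_mat n n"
  shows "sdet B = (\<Sum>xs\<in>permutations_of_set {0..<n}. row_det xs B)"
proof -
  let ?S = "\<lambda>s. {\<tau>. \<tau> permutes {0..<n} \<and> \<tau> s = s}"
  let ?g = "\<lambda>s \<tau> \<rho>. of_int (sign \<rho>) *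
    (\<Prod>t\<leftarrow>filter (\<lambda>t. t \<noteq> s) [0..<n]. B $$ (\<tau> t, \<rho> (\<tau> t)))"
  have dim: "dim_row B = n" "dim_col B = n" using B by auto
  have pre: "preadjoint B $$ (r, s) = (\<Sum>\<tau>\<in>?S s. \<Sum>\<rho> | \<rho> permutes {0..<n} \<and> \<rho> s = r. ?g s \<tau> \<rho>)"
    if "r < n" "s < n" for r s
    using that by (simp add: preadjoint_def dim)
  have fP: "finite {\<rho>. \<rho> permutes {0..<n}}"
    by (simp add: finite_permutations)
  have "sdet B = (\<Sum>r<n. \<Sum>s<n. preadjoint B $$ (r, s) * B $$ (s, r))"
    unfolding sdet_def mat_trace_def
    using dim by (auto simp: scalar_prod_def preadjoint_def Let_def lessThan_atLeast0 intro!: sum.cong)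
  also have "\<dots> = (\<Sum>s<n. \<Sum>r<n. preadjoint B $$ (r, s) * B $$ (s, r))"
    by (rule sum.swap)
  also have "\<dots> = (\<Sum>s<n. \<Sum>\<tau>\<in>?S s. row_det (rows_ending_in n s \<tau>) B)"
  proof (rule sum.cong[OF refl])
    fix s assume "s \<in> {..<n}"
    then have s: "s < n" by simp
    have "(\<Sum>r<n. preadjoint B $$ (r, s) * B $$ (s, r)) =
       (\<Sum>r<n. \<Sum>\<tau>\<in>?S s. \<Sum>\<rho> | \<rho> permutes {0..<n} \<and> \<rho> s = r. ?g s \<tau> \<rho> * B $$ (s, \<rho> s))"
      using s by (intro sum.cong refl) (simp add: pre sum_distrib_right)
    also have "\<dots> = (\<Sum>\<tau>\<in>?S s. \<Sum>r<n. \<Sum>\<rho> | \<rho> permutes {0..<n} \<and> \<rho> s = r. ?g s \<tau> \<rho> * B $$ (s, \<rho> s))"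
      by (rule sum.swap)
    also have "\<dots> = (\<Sum>\<tau>\<in>?S s. \<Sum>\<rho> | \<rho> permutes {0..<n}. ?g s \<tau> \<rho> * B $$ (s, \<rho> s))"
    proof (rule sum.cong[OF refl])
      fix \<tau>
      have "(\<lambda>\<rho>. \<rho> s) ` {\<rho>. \<rho> permutes {0..<n}} \<subseteq> {..<n}"
        using s permutes_in_image by fastforce
      from sum.group[OF fP _ this, of "\<lambda>\<rho>. ?g s \<tau> \<rho> * B $$ (s, \<rho> s)"]
      show "(\<Sum>r<n. \<Sum>\<rho> | \<rho> permutes {0..<n} \<and> \<rho> s = r. ?g s \<tau> \<rho> * B $$ (s, \<rho> s)) =
         (\<Sum>\<rho> | \<rho> permutes {0..<n}. ?g s \<tau> \<rho> * B $$ (s, \<rho> s))"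
        by simp
    qed
    also have "\<dots> = (\<Sum>\<tau>\<in>?S s. row_det (rows_ending_in n s \<tau>) B)"
      by (simp add: row_det_def rows_ending_in_def dim mult.assoc o_def)
    finally show "(\<Sum>r<n. preadjoint B $$ (r, s) * B $$ (s, r)) =
      (\<Sum>\<tau>\<in>?S s. row_det (rows_ending_in n s \<tau>) B)" .
  qed
  also have "\<dots> = (\<Sum>(s, \<tau>)\<in>(SIGMA s:{0..<n}. ?S s). row_det (rows_ending_in n s \<tau>) B)"
    by (subst sum.Sigma) (auto simp: finite_permutations lessThan_atLeast0)
  also have "\<dots> = (\<Sum>xs\<in>permutations_of_set {0..<n}. row_det xs B)"
    using sum.reindex_bij_betw[OF bij_betw_rows_ending_in[OF n], of "\<lambda>xs. row_det xs B"]
    by (simp add: case_prod_unfold)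
  finally show ?thesis .
qed

text \<open>The sum is over all orders of the n factors, so it does not matter whether the order is
  recorded through the row or the column indices: substituting \<open>map \<rho> xs\<close> for xs passes from one
  to the other and replaces \<open>\<rho>\<close> by its inverse, which has the same sign.\<close>

lemma sdet_transpose:
  assumes n: "0 < n" and B: "B \<in> carrier_mat n n"
  shows "sdet (transpose_mat B) = sdet B"
proof -
  let ?P = "permutations_of_set {0..<n}" and ?S = "{\<rho>. \<rho> permutes {0..<n}}"
  have dim: "dim_row B = n" "dim_col B = n" using B by auto
  have "sdet (transpose_mat B) = (\<Sum>xs\<in>?P. \<Sum>\<rho>\<in>?S. of_int (sign \<rho>) * (\<Prod>i\<leftarrow>xs. B $$ (\<rho> i, i)))"
    unfolding sdet_eq_sum_row_det[OF n transpose_carrier_mat[THEN iffD2, OF B]] row_det_def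
  proof (intro sum.cong)
    fix xs \<rho> assume "xs \<in> ?P" "\<rho> \<in> ?S"
    then have "map (\<lambda>i. B\<^sup>T $$ (i, \<rho> i)) xs = map (\<lambda>i. B $$ (\<rho> i, i)) xs"
      using dim permutes_in_image[of \<rho> "{0..<n}"] by (auto simp: permutations_of_set_def)
    then show "of_int (sign \<rho>) * (\<Prod>i\<leftarrow>xs. B\<^sup>T $$ (i, \<rho> i)) = of_int (sign \<rho>) * (\<Prod>i\<leftarrow>xs. B $$ (\<rho> i, i))"
      by (simp only:)
  qed (use dim in auto)
  also have "\<dots> = (\<Sum>\<rho>\<in>?S. \<Sum>xs\<in>?P. of_int (sign \<rho>) * (\<Prod>i\<leftarrow>xs. B $$ (\<rho> i, i)))"
    by (rule sum.swap)
  also have "\<dots> = (\<Sum>\<rho>\<in>?S. \<Sum>xs\<in>?P. of_int (sign \<rho>) * (\<Prod>i\<leftarrow>xs. B $$ (i, inv_into UNIV \<rho> i)))"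
  proof (rule sum.cong[OF refl])
    fix \<rho> assume "\<rho> \<in> ?S"
    then have \<rho>: "\<rho> permutes {0..<n}" by simp
    have "bij_betw (map \<rho>) ?P ?P"
    proof (rule bij_betw_imageI)
      show "inj_on (map \<rho>) ?P"
        using permutes_inj[OF \<rho>] by (simp add: inj_on_def)
      show "map \<rho> ` ?P = ?P"
        by (rule permutations_of_set_image_permutes[OF \<rho>])
    qed
    from sum.reindex_bij_betw[OF this, of "\<lambda>xs. of_int (sign \<rho>) * (\<Prod>i\<leftarrow>xs. B $$ (i, inv_into UNIV \<rho> i))"]
    show "(\<Sum>xs\<in>?P. of_int (sign \<rho>) * (\<Prod>i\<leftarrow>xs. B $$ (\<rho> i, i))) =
      (\<Sum>xs\<in>?P. of_int (sign \<rho>) * (\<Prod>i\<leftarrow>xs. B $$ (i, inv_into UNIV \<rho> i)))"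
      by (simp add: o_def permutes_inverses[OF \<rho>])
  qed
  also have "\<dots> = (\<Sum>\<rho>\<in>?S. \<Sum>xs\<in>?P. of_int (sign (inv_into UNIV \<rho>)) * (\<Prod>i\<leftarrow>xs. B $$ (i, inv_into UNIV \<rho> i)))"
    by (intro sum.cong refl) (simp add: sign_inverse permutes_imp_permutation[of "{0..<n}"])
  also have "\<dots> = (\<Sum>\<rho>\<in>?S. \<Sum>xs\<in>?P. of_int (sign \<rho>) * (\<Prod>i\<leftarrow>xs. B $$ (i, \<rho> i)))"
    by (rule sum_permutations_inverse[symmetric])
  also have "\<dots> = (\<Sum>xs\<in>?P. \<Sum>\<rho>\<in>?S. of_int (sign \<rho>) * (\<Prod>i\<leftarrow>xs. B $$ (i, \<rho> i)))"
    by (rule sum.swap)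
  also have "\<dots> = sdet B"
    by (simp add: sdet_eq_sum_row_det[OF n B] row_det_def dim)
  finally show ?thesis .
qed

lemma sdet_hom:
  assumes h: "Ring_Hom.ring_hom (h :: 'a::ring_1 \<Rightarrow> 'b::ring_1)"
    and n: "0 < n" and B: "B \<in> carrier_mat n n"
  shows "sdet (map_mat h B) = h (sdet B)"
proof -
  interpret h: ring_hom h by (rule h)
  have sgn: "h (of_int (sign \<rho>)) = of_int (sign \<rho>)" for \<rho> :: "nat \<Rightarrow> nat"
    by (simp add: sign_def h.hom_uminus)
  have dim: "dim_row B = n" "dim_col B = n" using B by auto
  have "row_det xs (map_mat h B) = h (row_det xs B)"
    if "xs \<in> permutations_of_set {0..<n}" for xs
    unfolding row_det_def h.hom_sum h.hom_mult sgn h.hom_prod_list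
  proof (intro sum.cong arg_cong2[of _ _ _ _ "(*)"] arg_cong[of _ _ prod_list] refl)
    fix \<rho> assume "\<rho> \<in> {\<rho>. \<rho> permutes {0..<dim_row B}}"
    then show "map (\<lambda>i. map_mat h B $$ (i, \<rho> i)) xs = map h (map (\<lambda>i. B $$ (i, \<rho> i)) xs)"
      using dim that permutes_in_image[of \<rho> "{0..<n}"] by (auto simp: permutations_of_set_def)
  qed simp
  then show ?thesis
    using B by (simp add: sdet_eq_sum_row_det[OF n] h.hom_sum)
qed

text \<open>Over a commutative ring the order of the factors is irrelevant, so each of the \<open>fact n\<close> row
  orders contributes the ordinary determinant.\<close>

lemma sdet_commutative:
  assumes n: "0 < n" and B: "(B :: 'a::comm_ring_1 mat) \<in> carrier_mat n n"
  shows "sdet B = of_nat (fact n) * det B"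
proof -
  have "row_det xs B = det B" if "xs \<in> permutations_of_set {0..<n}" for xs
  proof -
    have "(\<Prod>i\<leftarrow>xs. B $$ (i, \<rho> i)) = (\<Prod>i=0..<n. B $$ (i, \<rho> i))" for \<rho>
      using that prod.distinct_set_conv_list[of xs "\<lambda>i. B $$ (i, \<rho> i)"]
      by (simp add: permutations_of_set_def)
    then show ?thesis
      using B by (simp add: row_det_def det_def')
  qed
  then show ?thesis
    by (simp add: sdet_eq_sum_row_det[OF n B])
qed

section \<open>Multiplication by matrices over the centre\<close>

text \<open>Functions that choose a column below n for every row in I. Outside I they are the identity,
  so that the injective ones on \<open>{0..<n}\<close> are exactly the permutations in the sense of
  \<^const>\<open>permutes\<close>.\<close>

definition choice_fns :: "nat \<Rightarrow> nat set \<Rightarrow> (nat \<Rightarrow> nat) set" where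
  "choice_fns n I = {g. (\<forall>i\<in>I. g i < n) \<and> (\<forall>i. i \<notin> I \<longrightarrow> g i = i)}"

lemma choice_fns_empty: "choice_fns n {} = {id}"
  by (auto simp: choice_fns_def)

lemma bij_betw_choice_fns_insert:
  assumes "i \<notin> I"
  shows "bij_betw (\<lambda>(k, g). g(i := k)) ({..<n} \<times> choice_fns n I) (choice_fns n (insert i I))"
proof (rule bij_betw_byWitness[where f' = "\<lambda>g. (g i, g(i := i))"])
  show "\<forall>p\<in>{..<n} \<times> choice_fns n I. (\<lambda>g. (g i, g(i := i))) ((\<lambda>(k, g). g(i := k)) p) = p"
    using assms by (auto simp: choice_fns_def)
qed (use assms in \<open>auto simp: choice_fns_def\<close>)

lemma finite_choice_fns: "finite I \<Longrightarrow> finite (choice_fns n I)"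
proof (induction rule: finite_induct)
  case empty
  show ?case by (simp add: choice_fns_empty)
next
  case (insert i I)
  then show ?case
    using bij_betw_finite[OF bij_betw_choice_fns_insert[OF insert.hyps(2), of n]] by simp
qed

lemma prod_list_sum_distrib:
  fixes f :: "nat \<Rightarrow> nat \<Rightarrow> 'a::ring_1"
  assumes "distinct xs"
  shows "(\<Prod>i\<leftarrow>xs. \<Sum>k<n. f i k) = (\<Sum>g\<in>choice_fns n (set xs). \<Prod>i\<leftarrow>xs. f i (g i))"
  using assms
proof (induction xs)
  case Nil
  show ?case by (simp add: choice_fns_empty)
next
  case (Cons x xs)
  have upd: "map (\<lambda>i. f i ((g(x := k)) i)) xs = map (\<lambda>i. f i (g i)) xs" for g k
    using Cons.prems by auto
  have "(\<Prod>i\<leftarrow>x # xs. \<Sum>k<n. f i k)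
      = (\<Sum>k<n. \<Sum>g\<in>choice_fns n (set xs). f x k * (\<Prod>i\<leftarrow>xs. f i (g i)))"
    using Cons by (simp add: sum_product)
  also have "\<dots> = (\<Sum>(k, g)\<in>{..<n} \<times> choice_fns n (set xs). f x k * (\<Prod>i\<leftarrow>xs. f i (g i)))"
    by (rule sum.cartesian_product)
  also have "\<dots> = (\<Sum>(k, g)\<in>{..<n} \<times> choice_fns n (set xs). \<Prod>i\<leftarrow>x # xs. f i ((g(x := k)) i))"
    by (intro sum.cong refl) (auto simp only: upd list.map prod_list.Cons fun_upd_same)
  also have "\<dots> = (\<Sum>g\<in>choice_fns n (set (x # xs)). \<Prod>i\<leftarrow>x # xs. f i (g i))"
    using sum.reindex_bij_betw[OF bij_betw_choice_fns_insert[of x "set xs" n],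
        of "\<lambda>g. \<Prod>i\<leftarrow>x # xs. f i (g i)"] Cons.prems
    by (simp only: case_prod_unfold list.set distinct.simps not_False_eq_True)
  finally show ?case .
qed

lemma prod_list_mult_centre:
  "(\<Prod>i\<leftarrow>xs. f i * centre_rep (c i)) = (\<Prod>i\<leftarrow>xs. f i) * centre_rep (\<Prod>i\<leftarrow>xs. c i)"
proof (induction xs)
  case (Cons x xs)
  have "f x * centre_rep (c x) * ((\<Prod>i\<leftarrow>xs. f i) * centre_rep (\<Prod>i\<leftarrow>xs. c i)) =
    f x * (centre_rep (c x) * (\<Prod>i\<leftarrow>xs. f i)) * centre_rep (\<Prod>i\<leftarrow>xs. c i)"
    by (simp only: mult.assoc)
  with Cons show ?case
    by (simp add: centre_rep_commute[of "c x" "\<Prod>i\<leftarrow>xs. f i"] centre_rep.hom_mult mult.assoc)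
qed simp

lemma permutes_imp_choice_fn: "g permutes {0..<n} \<Longrightarrow> g \<in> choice_fns n {0..<n}"
  using permutes_in_image[of g "{0..<n}"] by (auto simp: choice_fns_def permutes_not_in)

text \<open>Selecting rows of S by g gives a matrix with two equal rows unless g is a permutation.\<close>

lemma det_choose_rows:
  fixes S :: "'a::comm_ring_1 mat"
  assumes S: "S \<in> carrier_mat n n" and g: "g \<in> choice_fns n {0..<n}"
  shows "(\<Sum>\<rho> | \<rho> permutes {0..<n}. of_int (sign \<rho>) * (\<Prod>i=0..<n. S $$ (g i, \<rho> i)))
    = (if g permutes {0..<n} then of_int (sign g) * det S else 0)"
proof -
  let ?M = "mat n n (\<lambda>(i, j). S $$ (g i, j))"
  have M: "?M \<in> carrier_mat n n" by simp
  have "det ?M = (\<Sum>\<rho> | \<rho> permutes {0..<n}. of_int (sign \<rho>) * (\<Prod>i=0..<n. S $$ (g i, \<rho> i)))"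
    unfolding det_def'[OF M]
  proof (intro sum.cong refl arg_cong2[of _ _ _ _ "(*)"] prod.cong)
    fix \<rho> i assume "\<rho> \<in> {\<rho>. \<rho> permutes {0..<n}}" "i \<in> {0..<n}"
    then show "?M $$ (i, \<rho> i) = S $$ (g i, \<rho> i)"
      using permutes_in_image[of \<rho> "{0..<n}"] by simp
  qed
  moreover have "det ?M = (if g permutes {0..<n} then of_int (sign g) * det S else 0)"
  proof (cases "g permutes {0..<n}")
    case True
    then show ?thesis
      by (simp add: det_permute_rows[OF S])
  next
    case False
    have "\<not> inj_on g {0..<n}"
    proof
      assume inj: "inj_on g {0..<n}"
      have "g ` {0..<n} = {0..<n}"
        using g inj by (intro endo_inj_surj) (auto simp: choice_fns_def)
      with inj have "bij_betw g {0..<n} {0..<n}"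
        by (simp add: bij_betw_def)
      with g False show False
        by (auto simp: choice_fns_def intro: bij_imp_permutes)
    qed
    then obtain i j where ij: "i < n" "j < n" "i \<noteq> j" "g i = g j"
      by (auto simp: inj_on_def)
    then have "row ?M i = row ?M j"
      by auto
    from det_identical_rows[OF M ij(3,1,2) this] False show ?thesis
      by simp
  qed
  ultimately show ?thesis by simp
qed

text \<open>This is the classical proof that determinants are multiplicative, for a fixed row order: the central
  entries of S can be moved out to the right of each product without disturbing the order of the
  entries of B. What they sum up to is a determinant of selected rows of S.\<close>

lemma row_det_mult_centre:
  fixes B :: "'a::ring_1 mat"
  assumes B: "B \<in> carrier_mat n n" and S: "S \<in> carrier_mat n n"
    and xs: "xs \<in> permutations_of_set {0..<n}"
  shows "row_det xs (B * map_mat centre_rep S) = row_det xs B * centre_rep (det S)"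
proof -
  let ?P = "{\<rho>. \<rho> permutes {0..<n}}" and ?F = "choice_fns n {0..<n}"
  let ?b = "\<lambda>g. \<Prod>i\<leftarrow>xs. B $$ (i, g i)"
  have xs': "distinct xs" "set xs = {0..<n}"
    using xs by (auto simp: permutations_of_set_def)
  have dim: "dim_row B = n" "dim_col B = n" "dim_row S = n" "dim_col S = n"
    using B S by auto
  have sgn_mult: "of_int (sign \<rho>) * (b * centre_rep c) = b * centre_rep (of_int (sign \<rho>) * c)"
    for \<rho> :: "nat \<Rightarrow> nat" and b :: 'a and c
    by (simp add: sign_def centre_rep.hom_uminus)
  have "(\<Prod>i\<leftarrow>xs. (B * map_mat centre_rep S) $$ (i, \<rho> i))
     = (\<Sum>g\<in>?F. ?b g * centre_rep (\<Prod>i=0..<n. S $$ (g i, \<rho> i)))" if "\<rho> \<in> ?P" for \<rho>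
  proof -
    have lt: "\<rho> i < n" if "i < n" for i
      using that \<open>\<rho> \<in> ?P\<close> permutes_in_image[of \<rho> "{0..<n}"] by simp
    have "map (\<lambda>i. (B * map_mat centre_rep S) $$ (i, \<rho> i)) xs
       = map (\<lambda>i. \<Sum>k<n. B $$ (i, k) * centre_rep (S $$ (k, \<rho> i))) xs"
      using xs' dim lt by (auto simp: scalar_prod_def lessThan_atLeast0 intro!: sum.cong)
    then have "(\<Prod>i\<leftarrow>xs. (B * map_mat centre_rep S) $$ (i, \<rho> i))
       = (\<Sum>g\<in>?F. \<Prod>i\<leftarrow>xs. B $$ (i, g i) * centre_rep (S $$ (g i, \<rho> i)))"
      using prod_list_sum_distrib[OF xs'(1), of "\<lambda>i k. B $$ (i, k) * centre_rep (S $$ (k, \<rho> i))" n]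
      by (simp only: xs'(2))
    also have "\<dots> = (\<Sum>g\<in>?F. ?b g * centre_rep (\<Prod>i\<leftarrow>xs. S $$ (g i, \<rho> i)))"
      by (simp only: prod_list_mult_centre)
    also have "\<dots> = (\<Sum>g\<in>?F. ?b g * centre_rep (\<Prod>i=0..<n. S $$ (g i, \<rho> i)))"
      by (simp only: prod.distinct_set_conv_list[OF xs'(1), unfolded xs'(2)])
    finally show ?thesis .
  qed
  then have "row_det xs (B * map_mat centre_rep S)
    = (\<Sum>\<rho>\<in>?P. \<Sum>g\<in>?F. of_int (sign \<rho>) * (?b g * centre_rep (\<Prod>i=0..<n. S $$ (g i, \<rho> i))))"
    unfolding row_det_def by (simp add: dim sum_distrib_left)
  also have "\<dots> = (\<Sum>\<rho>\<in>?P. \<Sum>g\<in>?F.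
      ?b g * centre_rep (of_int (sign \<rho>) * (\<Prod>i=0..<n. S $$ (g i, \<rho> i))))"
    by (simp only: sgn_mult)
  also have "\<dots> = (\<Sum>g\<in>?F. \<Sum>\<rho>\<in>?P.
      ?b g * centre_rep (of_int (sign \<rho>) * (\<Prod>i=0..<n. S $$ (g i, \<rho> i))))"
    by (rule sum.swap)
  also have "\<dots> = (\<Sum>g\<in>?F. ?b g *
      centre_rep (\<Sum>\<rho>\<in>?P. of_int (sign \<rho>) * (\<Prod>i=0..<n. S $$ (g i, \<rho> i))))"
    by (simp only: centre_rep.hom_sum sum_distrib_left)
  also have "\<dots> = (\<Sum>g\<in>?F. if g permutes {0..<n}
      then ?b g * centre_rep (of_int (sign g) * det S) else 0)"
    by (intro sum.cong refl) (simp add: det_choose_rows[OF S])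
  also have "\<dots> = (\<Sum>g\<in>?P. ?b g * centre_rep (of_int (sign g) * det S))"
    by (rule sum.mono_neutral_cong_right)
      (auto simp: finite_choice_fns permutes_imp_choice_fn)
  also have "\<dots> = (\<Sum>g\<in>?P. of_int (sign g) * ?b g * centre_rep (det S))"
    by (simp only: sgn_mult mult.assoc)
  also have "\<dots> = row_det xs B * centre_rep (det S)"
    unfolding row_det_def by (simp add: dim sum_distrib_right)
  finally show ?thesis .
qed

lemma sdet_mult_centre_right:
  assumes n: "0 < n" and "B \<in> carrier_mat n n" and "S \<in> carrier_mat n n"
  shows "sdet (B * map_mat centre_rep S) = sdet B * centre_rep (det S)"
proof -
  have "B * map_mat centre_rep S \<in> carrier_mat n n"
    using assms by simp
  then show ?thesis
    using assms by (simp add: sdet_eq_sum_row_det[OF n] row_det_mult_centre[of _ n] sum_distrib_right)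
qed

text \<open>Over a noncommutative ring transposition does not reverse products in general; it does when one of
  the factors is central.\<close>

lemma transpose_mult_centre:
  assumes "B \<in> carrier_mat n n" and "T \<in> carrier_mat n n"
  shows "transpose_mat (map_mat centre_rep T * B)
    = transpose_mat B * map_mat centre_rep (transpose_mat T)"
  using assms
  by (intro eq_matI) (auto simp: scalar_prod_def centre_rep_commute intro!: sum.cong)

lemma sdet_mult_centre_left:
  assumes n: "0 < n" and B: "B \<in> carrier_mat n n" and T: "T \<in> carrier_mat n n"
  shows "sdet (map_mat centre_rep T * B) = sdet B * centre_rep (det T)"
proof -
  have "sdet (map_mat centre_rep T * B) = sdet (transpose_mat (map_mat centre_rep T * B))"
    using B T by (intro sdet_transpose[OF n, symmetric]) simp
  also have "\<dots> = sdet (transpose_mat B) * centre_rep (det (transpose_mat T))"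
    unfolding transpose_mult_centre[OF B T]
    using B T by (intro sdet_mult_centre_right[OF n]) simp_all
  also have "\<dots> = sdet B * centre_rep (det T)"
    by (simp add: sdet_transpose[OF n B] det_transpose[OF T])
  finally show ?thesis .
qed

text \<open>The determinants of T and S, formed in the centre, are inverse to each other and cancel.\<close>

theorem sdet_conjugate:
  fixes B T S :: "'a::ring_1 mat"
  assumes n: "0 < n"
    and B: "B \<in> carrier_mat n n" and T: "T \<in> carrier_mat n n" and S: "S \<in> carrier_mat n n"
    and TC: "elements_mat T \<subseteq> ring_centre" and SC: "elements_mat S \<subseteq> ring_centre"
    and TS: "T * S = 1\<^sub>m n"
  shows "sdet (T * B * S) = sdet B"
proof -
  define T' S' where "T' = map_mat centre_abs T" and "S' = map_mat centre_abs S"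
  have c: "T' \<in> carrier_mat n n" "S' \<in> carrier_mat n n"
    using T S by (simp_all add: T'_def S'_def)
  have rep: "map_mat centre_rep T' = T" "map_mat centre_rep S' = S"
    using mat_over_centre[OF TC T] mat_over_centre[OF SC S] by (simp_all add: T'_def S'_def)
  have "map_mat centre_rep (T' * S') = map_mat centre_rep (1\<^sub>m n)"
    using c TS by (simp add: centre_rep.mat_hom_mult[of _ n n] centre_rep.mat_hom_one rep)
  then have "T' * S' = 1\<^sub>m n"
    using c by (auto simp: mat_eq_iff centre_rep_inject)
  then have det: "det T' * det S' = 1"
    using det_mult[OF c] by simp
  have "sdet (T * B * S) = sdet B * centre_rep (det T') * centre_rep (det S')"
    using sdet_mult_centre_right[OF n, of "T * B" S'] sdet_mult_centre_left[OF n B c(1)] B T c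
    by (simp add: rep)
  also have "\<dots> = sdet B * centre_rep (det T' * det S')"
    by (simp add: centre_rep.hom_mult mult.assoc)
  finally show ?thesis
    by (simp add: det)
qed

section \<open>Polynomials\<close>

lemma lookup_mult_nat:
  fixes p q :: "'a::ring_1 ncpoly"
  shows "Poly_Mapping.lookup (p * q) k
    = (\<Sum>i\<le>k. Poly_Mapping.lookup p i * Poly_Mapping.lookup q (k - i))"
proof -
  have inner: "(\<Sum>j. Poly_Mapping.lookup q j when k = i + j)
      = (Poly_Mapping.lookup q (k - i) when i \<le> k)" for i
  proof (cases "i \<le> k")
    case True
    then have "(\<lambda>j. Poly_Mapping.lookup q j when k = i + j) = (\<lambda>j. Poly_Mapping.lookup q j when j = k - i)"
      by (auto simp: when_def)
    with True show ?thesis by (simp only: Sum_any_when_equal) simp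
  next
    case False
    then have "(\<lambda>j. Poly_Mapping.lookup q j when k = i + j) = (\<lambda>j. 0)"
      by (auto simp: when_def)
    with False show ?thesis by (simp only: Sum_any.neutral) simp
  qed
  have "Poly_Mapping.lookup (p * q) k
      = (\<Sum>i. Poly_Mapping.lookup p i * (Poly_Mapping.lookup q (k - i) when i \<le> k))"
    by (simp only: lookup_mult inner)
  also have "\<dots> = (\<Sum>i\<le>k. Poly_Mapping.lookup p i * (Poly_Mapping.lookup q (k - i) when i \<le> k))"
    by (rule Sum_any.expand_superset) (auto simp: when_def split: if_splits)
  also have "\<dots> = (\<Sum>i\<le>k. Poly_Mapping.lookup p i * Poly_Mapping.lookup q (k - i))"
    by (intro sum.cong) (auto simp: when_def)
  finally show ?thesis .
qed

interpretation poly_C: ring_hom "poly_C :: 'a::ring_1 \<Rightarrow> 'a ncpoly"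
  by unfold_locales (simp_all add: poly_C_def single_add mult_single)

lemma poly_X_power: "(poly_X :: 'a::ring_1 ncpoly) ^ i = Poly_Mapping.single i 1"
  by (induction i) (simp_all add: poly_X_def mult_single)

lemma poly_X_commute: "poly_X * p = p * (poly_X :: 'a::ring_1 ncpoly)"
proof (rule poly_mapping_eqI)
  fix k
  have "Poly_Mapping.lookup (poly_X * p) k = (if k = 0 then 0 else Poly_Mapping.lookup p (k - 1))"
    by (simp add: lookup_mult_nat poly_X_def lookup_single when_def if_distrib[of "\<lambda>x. x * _"] cong: if_cong)
  moreover have "Poly_Mapping.lookup (p * poly_X) k = (\<Sum>i\<le>k. if i = k - 1 \<and> k \<noteq> 0 then Poly_Mapping.lookup p i else 0)"
    unfolding lookup_mult_nat by (intro sum.cong) (auto simp: poly_X_def lookup_single when_def)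
  ultimately show "Poly_Mapping.lookup (poly_X * p) k = Poly_Mapping.lookup (p * poly_X) k"
    by (cases k) simp_all
qed

lemma poly_C_centre:
  assumes "z \<in> ring_centre"
  shows "poly_C z \<in> ring_centre"
proof -
  have "poly_C z * p = p * poly_C z" for p
  proof (rule poly_mapping_eqI)
    fix k
    have "Poly_Mapping.lookup (poly_C z * p) k = z * Poly_Mapping.lookup p k"
      by (simp add: lookup_mult_nat poly_C_def lookup_single when_def if_distrib[of "\<lambda>x. x * _"] cong: if_cong)
    moreover have "Poly_Mapping.lookup (p * poly_C z) k
        = (\<Sum>i\<le>k. if i = k then Poly_Mapping.lookup p i * z else 0)"
      unfolding lookup_mult_nat by (intro sum.cong) (auto simp: poly_C_def lookup_single when_def)
    moreover have "z * Poly_Mapping.lookup p k = Poly_Mapping.lookup p k * z"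
      using assms unfolding ring_centre_def by blast
    ultimately show "Poly_Mapping.lookup (poly_C z * p) k = Poly_Mapping.lookup (p * poly_C z) k"
      by simp
  qed
  then show ?thesis
    unfolding ring_centre_def by blast
qed

text \<open>The map on polynomials induced by h; it lands in the library type of polynomials, where the
  characteristic polynomial over a commutative ring lives.\<close>

definition ncpoly_hom :: "('a::ring_1 \<Rightarrow> 'b::comm_ring_1) \<Rightarrow> 'a ncpoly \<Rightarrow> 'b poly" where
  "ncpoly_hom h p = (\<Sum>i\<in>Poly_Mapping.keys p. monom (h (Poly_Mapping.lookup p i)) i)"

lemma coeff_ncpoly_hom:
  assumes "h 0 = 0"
  shows "coeff (ncpoly_hom h p) k = h (Poly_Mapping.lookup p k)"
  using assms by (auto simp: ncpoly_hom_def coeff_sum in_keys_iff)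

lemma ncpoly_hom:
  assumes h: "Ring_Hom.ring_hom h"
  shows "Ring_Hom.ring_hom (ncpoly_hom h)"
proof -
  interpret h: ring_hom h by (rule h)
  show ?thesis
    by unfold_locales
      (auto intro!: poly_eqI simp: coeff_ncpoly_hom lookup_add h.hom_add lookup_one when_def
        coeff_mult lookup_mult_nat h.hom_sum h.hom_mult)
qed

section \<open>The symmetric characteristic polynomial\<close>

abbreviation char_matrix_nc :: "nat \<Rightarrow> 'a::ring_1 mat \<Rightarrow> 'a ncpoly mat" where
  "char_matrix_nc n A \<equiv> poly_X \<cdot>\<^sub>m 1\<^sub>m n - map_mat poly_C A"

lemma ncpoly_hom_char_matrix:
  assumes h: "Ring_Hom.ring_hom h" and A: "A \<in> carrier_mat n n"
  shows "map_mat (ncpoly_hom h) (char_matrix_nc n A) = char_poly_matrix (map_mat h A)"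
proof -
  interpret h: ring_hom h by (rule h)
  show ?thesis
    using A
    by (intro eq_matI poly_eqI)
      (auto simp: char_poly_matrix_def coeff_ncpoly_hom lookup_minus poly_X_def poly_C_def
        lookup_single when_def coeff_pCons h.hom_minus h.hom_uminus lookup_one lookup_zero split: nat.splits)
qed

text \<open>Symmetric determinants commute with ring homomorphisms, so over any commutative image of the ring
  the symmetric characteristic polynomial becomes \<open>fact n\<close> times the ordinary one.\<close>

lemma sym_char_coeff_hom:
  assumes h: "Ring_Hom.ring_hom h" and n: "0 < n" and A: "A \<in> carrier_mat n n"
  shows "h (sym_char_coeff A k) = of_nat (fact n) * coeff (char_poly (map_mat h A)) k"
proof -
  interpret h: ring_hom h by (rule h)
  have dim: "dim_row A = n" using A by simp
  have B: "char_matrix_nc n A \<in> carrier_mat n n"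
    using A by (intro carrier_matI) simp_all
  have "ncpoly_hom h (sym_char_poly A) = sdet (char_poly_matrix (map_mat h A))"
    using sdet_hom[OF ncpoly_hom[OF h] n B]
    by (simp add: sym_char_poly_def dim ncpoly_hom_char_matrix[OF h A])
  also have "\<dots> = of_nat (fact n) * char_poly (map_mat h A)"
    using A by (simp add: char_poly_def sdet_commutative[OF n])
  finally have "coeff (ncpoly_hom h (sym_char_poly A)) k
      = coeff (of_nat (fact n) * char_poly (map_mat h A)) k"
    by simp
  then show ?thesis
    by (simp add: sym_char_coeff_def coeff_ncpoly_hom of_nat_poly)
qed

text \<open>A product of polynomials of degree at most 1 has degree at most the number of its factors, and its
  top coefficient is the ordered product of the linear coefficients.\<close>

lemma lookup_prod_list_linear:
  fixes f :: "'b \<Rightarrow> 'a::ring_1 ncpoly"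
  assumes "\<And>i m. i \<in> set xs \<Longrightarrow> m > 1 \<Longrightarrow> Poly_Mapping.lookup (f i) m = 0"
  shows "(\<forall>m > length xs. Poly_Mapping.lookup (\<Prod>i\<leftarrow>xs. f i) m = 0) \<and>
    Poly_Mapping.lookup (\<Prod>i\<leftarrow>xs. f i) (length xs) = (\<Prod>i\<leftarrow>xs. Poly_Mapping.lookup (f i) 1)"
  using assms
proof (induction xs)
  case Nil
  show ?case by (simp add: lookup_one)
next
  case (Cons x xs)
  let ?l = "Poly_Mapping.lookup (\<Prod>i\<leftarrow>xs. f i)"
  have IH: "?l m = 0" if "m > length xs" for m
    using Cons that by simp
  have split: "Poly_Mapping.lookup (f x * (\<Prod>i\<leftarrow>xs. f i)) (Suc m)
      = Poly_Mapping.lookup (f x) 0 * ?l (Suc m) + Poly_Mapping.lookup (f x) 1 * ?l m" for m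
  proof -
    have "Poly_Mapping.lookup (f x * (\<Prod>i\<leftarrow>xs. f i)) (Suc m)
        = (\<Sum>i\<in>{0, 1}. Poly_Mapping.lookup (f x) i * ?l (Suc m - i))"
      unfolding lookup_mult_nat
    proof (rule sum.mono_neutral_right)
      show "\<forall>i\<in>{..Suc m} - {0, 1}. Poly_Mapping.lookup (f x) i * ?l (Suc m - i) = 0"
        using Cons.prems[of x] by auto
    qed auto
    then show ?thesis by simp
  qed
  show ?case
  proof (intro conjI allI impI)
    fix m assume "m > length (x # xs)"
    then obtain m' where "m = Suc m'" "m' > length xs"
      by (cases m) auto
    then show "Poly_Mapping.lookup (\<Prod>i\<leftarrow>x # xs. f i) m = 0"
      by (simp add: split IH)
  next
    show "Poly_Mapping.lookup (\<Prod>i\<leftarrow>x # xs. f i) (length (x # xs))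
      = (\<Prod>i\<leftarrow>x # xs. Poly_Mapping.lookup (f i) 1)"
      using Cons by (simp add: split IH)
  qed
qed

lemma lookup_sign_mult:
  "Poly_Mapping.lookup (of_int (sign \<rho>) * p) k = of_int (sign \<rho>) * Poly_Mapping.lookup p k"
  for p :: "'a::ring_1 ncpoly"
  by (simp add: sign_def)

text \<open>The linear coefficient of an entry of the characteristic matrix is that of the unit matrix. Hence
  in each row order only the identity permutation reaches degree n, with coefficient 1, and there
  are \<open>fact n\<close> row orders.\<close>

lemma sym_char_coeff_top:
  fixes A :: "'a::ring_1 mat"
  assumes n: "0 < n" and A: "A \<in> carrier_mat n n"
  shows "m > n \<Longrightarrow> sym_char_coeff A m = 0"
    and "sym_char_coeff A n = of_nat (fact n)"
proof -
  let ?P = "permutations_of_set {0..<n}" and ?S = "{\<rho>. \<rho> permutes {0..<n}}"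
  let ?B = "char_matrix_nc n A"
  have dim: "dim_row A = n" "dim_col A = n" using A by auto
  then have B: "?B \<in> carrier_mat n n" by (intro carrier_matI) simp_all
  have entry: "Poly_Mapping.lookup (?B $$ (i, j)) k = 0" if "i < n" "j < n" "k > 1" for i j k
    using that dim by (simp add: lookup_minus poly_X_def poly_C_def lookup_single)
  have entry1: "Poly_Mapping.lookup (?B $$ (i, j)) 1 = (if i = j then 1 else 0)"
    if "i < n" "j < n" for i j
    using that dim by (simp add: lookup_minus poly_X_def poly_C_def lookup_single)
  have coeff: "sym_char_coeff A k = (\<Sum>xs\<in>?P. \<Sum>\<rho>\<in>?S.
      of_int (sign \<rho>) * Poly_Mapping.lookup (\<Prod>i\<leftarrow>xs. ?B $$ (i, \<rho> i)) k)" for k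
    by (simp add: sym_char_coeff_def sym_char_poly_def dim sdet_eq_sum_row_det[OF n B]
        row_det_def lookup_sum lookup_sign_mult)
  have *: "(\<forall>m > n. Poly_Mapping.lookup (\<Prod>i\<leftarrow>xs. ?B $$ (i, \<rho> i)) m = 0) \<and>
      Poly_Mapping.lookup (\<Prod>i\<leftarrow>xs. ?B $$ (i, \<rho> i)) n = (if \<rho> = id then 1 else 0)"
    if xs: "xs \<in> ?P" and \<rho>: "\<rho> \<in> ?S" for xs \<rho>
  proof -
    have set: "set xs = {0..<n}" and len: "length xs = n"
      using permutations_of_setD[OF xs] length_finite_permutations_of_set[OF xs] by auto
    have lt: "\<rho> i < n" if "i < n" for i
      using \<rho> that permutes_in_image[of \<rho> "{0..<n}"] by simp
    have top: "(\<Prod>i\<leftarrow>xs. Poly_Mapping.lookup (?B $$ (i, \<rho> i)) 1) = (if \<rho> = id then 1 else 0)"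
    proof -
      have "map (\<lambda>i. Poly_Mapping.lookup (?B $$ (i, \<rho> i)) 1) xs
          = map (\<lambda>i. if i = \<rho> i then 1 else 0) xs"
        using set lt entry1 by simp
      moreover have "(\<Prod>i\<leftarrow>xs. if i = \<rho> i then 1 else (0::'a)) = (if \<forall>i\<in>set xs. i = \<rho> i then 1 else 0)"
        by (induction xs) auto
      moreover have "(\<forall>i\<in>set xs. i = \<rho> i) \<longleftrightarrow> \<rho> = id"
        using \<rho> set by (metis atLeastLessThan_iff eq_id_iff mem_Collect_eq permutes_not_in)
      ultimately show ?thesis by (simp only:)
    qed
    have "(\<forall>m > length xs. Poly_Mapping.lookup (\<Prod>i\<leftarrow>xs. ?B $$ (i, \<rho> i)) m = 0) \<and>
        Poly_Mapping.lookup (\<Prod>i\<leftarrow>xs. ?B $$ (i, \<rho> i)) (length xs)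
          = (\<Prod>i\<leftarrow>xs. Poly_Mapping.lookup (?B $$ (i, \<rho> i)) 1)"
      by (rule lookup_prod_list_linear) (use set lt entry in auto)
    then show ?thesis
      unfolding len top .
  qed
  show "sym_char_coeff A m = 0" if "m > n"
    unfolding coeff using * that by simp
  have "sym_char_coeff A n = (\<Sum>xs\<in>?P. \<Sum>\<rho>\<in>?S. if \<rho> = id then 1 else 0)"
    unfolding coeff by (intro sum.cong refl) (simp add: *)
  also have "\<dots> = (\<Sum>xs\<in>?P. 1)"
    by (intro sum.cong refl) (simp add: finite_permutations permutes_id)
  finally show "sym_char_coeff A n = of_nat (fact n)"
    by simp
qed

lemma sym_char_poly_expansion:
  assumes n: "0 < n" and A: "A \<in> carrier_mat n n"
  shows "sym_char_poly A = (\<Sum>i\<le>n. poly_C (sym_char_coeff A i) * poly_X ^ i)"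
proof (rule poly_mapping_eqI)
  fix k
  have "Poly_Mapping.lookup (\<Sum>i\<le>n. poly_C (sym_char_coeff A i) * poly_X ^ i) k
      = (\<Sum>i\<le>n. if i = k then sym_char_coeff A i else 0)"
    by (simp add: lookup_sum poly_C_def poly_X_power mult_single lookup_single when_def)
  also have "\<dots> = sym_char_coeff A k"
    using sym_char_coeff_top(1)[OF n A, of k] by auto
  finally show "Poly_Mapping.lookup (sym_char_poly A) k
      = Poly_Mapping.lookup (\<Sum>i\<le>n. poly_C (sym_char_coeff A i) * poly_X ^ i) k"
    by (simp add: sym_char_coeff_def)
qed

text \<open>Over the polynomial ring, conjugating A amounts to conjugating its characteristic matrix, because
  the indeterminate is central; the entries of T and S remain central there.\<close>

theorem sym_char_poly_conjugate:
  fixes A T S :: "'a::ring_1 mat"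
  assumes n: "0 < n" and A: "A \<in> carrier_mat n n"
    and T: "T \<in> carrier_mat n n" and S: "S \<in> carrier_mat n n"
    and TC: "elements_mat T \<subseteq> ring_centre" and SC: "elements_mat S \<subseteq> ring_centre"
    and TS: "T * S = 1\<^sub>m n"
  shows "sym_char_poly (T * A * S) = sym_char_poly A"
proof -
  let ?c = "map_mat (poly_C :: 'a \<Rightarrow> 'a ncpoly)"
  have c: "?c A \<in> carrier_mat n n" "?c T \<in> carrier_mat n n" "?c S \<in> carrier_mat n n"
    using A T S by simp_all
  have X: "poly_X \<cdot>\<^sub>m 1\<^sub>m n \<in> carrier_mat n n" by simp
  have hom: "?c (T * A * S) = ?c T * ?c A * ?c S" "?c T * ?c S = 1\<^sub>m n"
    using poly_C.mat_hom_mult[of "T * A" n n S n] poly_C.mat_hom_mult[of T n n A n]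
      poly_C.mat_hom_mult[of T n n S n] A T S TS
    by (simp_all add: poly_C.mat_hom_one)
  have Xcomm: "?c T * (poly_X \<cdot>\<^sub>m 1\<^sub>m n) = poly_X \<cdot>\<^sub>m ?c T"
    using T by (intro eq_matI)
      (auto simp: scalar_prod_def poly_X_commute if_distrib[of "\<lambda>x. _ * x"] cong: if_cong)
  have "?c T * char_matrix_nc n A * ?c S
      = ?c T * (poly_X \<cdot>\<^sub>m 1\<^sub>m n) * ?c S - ?c T * ?c A * ?c S"
    by (simp only: mult_minus_distrib_mat[OF c(2) X c(1)]
        minus_mult_distrib_mat[OF mult_carrier_mat[OF c(2) X] mult_carrier_mat[OF c(2,1)] c(3)])
  also have "?c T * (poly_X \<cdot>\<^sub>m 1\<^sub>m n) * ?c S = poly_X \<cdot>\<^sub>m (?c T * ?c S)"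
    unfolding Xcomm using c by (intro eq_matI) (auto simp: scalar_prod_def sum_distrib_left mult.assoc)
  finally have "?c T * char_matrix_nc n A * ?c S = char_matrix_nc n (T * A * S)"
    by (simp only: hom)
  moreover have "sdet (?c T * char_matrix_nc n A * ?c S) = sdet (char_matrix_nc n A)"
  proof (rule sdet_conjugate[OF n])
    show "elements_mat (?c T) \<subseteq> ring_centre" "elements_mat (?c S) \<subseteq> ring_centre"
      using TC SC by (auto simp: poly_C_centre)
  qed (use A T S hom in auto)
  ultimately show ?thesis
    using A T S by (simp add: sym_char_poly_def)
qed

section \<open>The Cayley-Hamilton identity\<close>

text \<open>Comparing coefficients in \<open>adj M * M = p I\<close> for \<open>M = x I - A\<close> gives
  \<open>C_(m - 1) - C_m A = p_m I\<close>, where \<open>C_m\<close> is the coefficient matrix of \<open>adj M\<close> at \<open>x ^ m\<close>.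
  Multiplying by \<open>A ^ m\<close> on the right and summing over m telescopes.\<close>

lemma cayley_hamilton_entry:
  fixes A :: "'a::comm_ring_1 mat"
  assumes A: "A \<in> carrier_mat n n" and ij: "i < n" "j < n"
  shows "(\<Sum>m\<le>n. coeff (char_poly A) m * (A ^\<^sub>m m) $$ (i, j)) = 0"
proof -
  let ?M = "char_poly_matrix A" and ?p = "char_poly A"
  define C where "C = adj_mat ?M"
  define c where "c m k = coeff (C $$ (i, k)) m" for m k
  have dim: "dim_row A = n" "dim_col A = n" using A by auto
  have M: "?M \<in> carrier_mat n n" using A by simp
  have C: "C \<in> carrier_mat n n" and CM: "C * ?M = ?p \<cdot>\<^sub>m 1\<^sub>m n"
    using adj_mat[OF M] by (simp_all add: C_def char_poly_def)
  have entry: "(\<Sum>k<n. C $$ (i, k) * ?M $$ (k, l)) = (if i = l then ?p else 0)" if "l < n" for l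
  proof -
    have "(C * ?M) $$ (i, l) = (?p \<cdot>\<^sub>m 1\<^sub>m n) $$ (i, l)"
      by (simp only: CM)
    then show ?thesis
      using that ij C M by (auto simp: scalar_prod_def lessThan_atLeast0)
  qed
  have M_entry: "q * ?M $$ (k, l) = (if k = l then pCons 0 q else 0) - smult (A $$ (k, l)) q"
    if "k < n" "l < n" for k l and q
    using that dim by (simp add: char_poly_matrix_def algebra_simps)
  have coeffs: "(if i = l then coeff ?p m else 0)
      = (if m = 0 then 0 else c (m - 1) l) - (\<Sum>k<n. c m k * A $$ (k, l))" if "l < n" for l m
  proof -
    have "(if i = l then coeff ?p m else 0) = coeff (\<Sum>k<n. C $$ (i, k) * ?M $$ (k, l)) m"
      using entry[OF that] by simp
    also have "\<dots> = (\<Sum>k<n. (if k = l then coeff (pCons 0 (C $$ (i, l))) m else 0) - c m k * A $$ (k, l))"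
      unfolding coeff_sum by (intro sum.cong refl) (simp add: M_entry that c_def mult.commute)
    also have "\<dots> = coeff (pCons 0 (C $$ (i, l))) m - (\<Sum>k<n. c m k * A $$ (k, l))"
      using that by (simp add: sum_subtractf)
    also have "coeff (pCons 0 (C $$ (i, l))) m = (if m = 0 then 0 else c (m - 1) l)"
      by (cases m) (simp_all add: c_def)
    finally show ?thesis .
  qed
  have pow: "A ^\<^sub>m m \<in> carrier_mat n n" for m
    using A by simp
  have pow_Suc: "(\<Sum>l<n. A $$ (k, l) * (A ^\<^sub>m m) $$ (l, j)) = (A ^\<^sub>m Suc m) $$ (k, j)"
    if "k < n" for k m
  proof -
    have "A * A ^\<^sub>m m = A ^\<^sub>m m * A"
    proof (induction m)
      case 0
      then show ?case using A by simp
    next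
      case (Suc m)
      then show ?case using assoc_mult_mat[OF A pow A, of m] by simp
    qed
    then have "A ^\<^sub>m Suc m = A * A ^\<^sub>m m" by simp
    then show ?thesis
      using that ij dim pow by (simp add: scalar_prod_def lessThan_atLeast0)
  qed
  have summand: "coeff ?p m * (A ^\<^sub>m m) $$ (i, j)
      = (if m = 0 then 0 else \<Sum>l<n. c (m - 1) l * (A ^\<^sub>m m) $$ (l, j))
        - (\<Sum>k<n. c m k * (A ^\<^sub>m Suc m) $$ (k, j))" for m
  proof -
    have "coeff ?p m * (A ^\<^sub>m m) $$ (i, j)
        = (\<Sum>l<n. (if i = l then coeff ?p m else 0) * (A ^\<^sub>m m) $$ (l, j))"
      using ij by (simp add: if_distrib[of "\<lambda>x. x * _"] cong: if_cong)
    also have "\<dots> = (\<Sum>l<n. (if m = 0 then 0 else c (m - 1) l) * (A ^\<^sub>m m) $$ (l, j))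
        - (\<Sum>l<n. \<Sum>k<n. c m k * A $$ (k, l) * (A ^\<^sub>m m) $$ (l, j))"
      by (simp add: coeffs left_diff_distrib sum_subtractf sum_distrib_right)
    also have "(\<Sum>l<n. \<Sum>k<n. c m k * A $$ (k, l) * (A ^\<^sub>m m) $$ (l, j))
        = (\<Sum>k<n. \<Sum>l<n. c m k * A $$ (k, l) * (A ^\<^sub>m m) $$ (l, j))"
      by (rule sum.swap)
    also have "\<dots> = (\<Sum>k<n. c m k * (A ^\<^sub>m Suc m) $$ (k, j))"
      by (intro sum.cong refl) (simp add: mult.assoc pow_Suc flip: sum_distrib_left del: pow_mat.simps)
    finally show ?thesis by (cases "m = 0") simp_all
  qed
  \<comment> \<open>Only the last term of the telescoping sum survives.\<close>
  have partial: "(\<Sum>m\<le>N. coeff ?p m * (A ^\<^sub>m m) $$ (i, j))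
      = - (\<Sum>k<n. c N k * (A ^\<^sub>m Suc N) $$ (k, j))" for N
    by (induction N) (simp_all add: summand del: pow_mat.simps)
  \<comment> \<open>N exceeds the degrees of all entries of row i of the adjugate and is at least n, the degree
    of the characteristic polynomial.\<close>
  define N where "N = n + (\<Sum>k<n. Suc (degree (C $$ (i, k))))"
  have "c N k = 0" if "k < n" for k
  proof -
    have "Suc (degree (C $$ (i, k))) \<le> (\<Sum>k<n. Suc (degree (C $$ (i, k))))"
      using that by (intro member_le_sum) auto
    then show ?thesis
      by (simp add: c_def coeff_eq_0 N_def)
  qed
  then have "(\<Sum>m\<le>N. coeff ?p m * (A ^\<^sub>m m) $$ (i, j)) = 0"
    by (simp only: partial) simp
  moreover have "(\<Sum>m\<le>N. coeff ?p m * (A ^\<^sub>m m) $$ (i, j)) = (\<Sum>m\<le>n. coeff ?p m * (A ^\<^sub>m m) $$ (i, j))"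
    using degree_monic_char_poly[OF A]
    by (intro sum.mono_neutral_right) (auto simp: N_def coeff_eq_0)
  ultimately show ?thesis by simp
qed

text \<open>Modulo the commutator ideal both expressions become \<open>fact n\<close> times an entry of the ordinary
  characteristic polynomial evaluated at its matrix; on which side the coefficients stand is
  irrelevant there.\<close>

lemma sym_char_poly_mod_comm_ideal:
  fixes A :: "'a::ring_1 mat"
  assumes one: "1 \<notin> (comm_ideal :: 'a set)" and n: "0 < n"
    and A: "A \<in> carrier_mat n n" and rk: "r < n" "k < n"
  shows "(\<Sum>i\<le>n. (A ^\<^sub>m i) $$ (r, k) * sym_char_coeff A i) \<in> comm_ideal"
    and "(\<Sum>i\<le>n. sym_char_coeff A i * (A ^\<^sub>m i) $$ (r, k)) \<in> comm_ideal"
proof -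
  interpret h: ring_hom "abs_ab :: 'a \<Rightarrow> 'a ab" by (rule abs_ab_hom(1)[OF one])
  let ?h = "abs_ab :: 'a \<Rightarrow> 'a ab"
  have pow: "?h ((A ^\<^sub>m i) $$ (r, k)) = (map_mat ?h A ^\<^sub>m i) $$ (r, k)" for i
    using rk A by (simp flip: h.mat_hom_pow[OF A])
  have "(\<Sum>i\<le>n. ?h (sym_char_coeff A i) * ?h ((A ^\<^sub>m i) $$ (r, k)))
      = of_nat (fact n) * (\<Sum>i\<le>n. coeff (char_poly (map_mat ?h A)) i * (map_mat ?h A ^\<^sub>m i) $$ (r, k))"
    by (simp only: pow sym_char_coeff_hom[OF h.ring_hom_axioms n A] sum_distrib_left mult.assoc)
  also have "\<dots> = 0"
    using cayley_hamilton_entry[of "map_mat ?h A" n r k] A rk by simp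
  finally have zero: "(\<Sum>i\<le>n. ?h (sym_char_coeff A i) * ?h ((A ^\<^sub>m i) $$ (r, k))) = 0" .
  then have "?h (\<Sum>i\<le>n. sym_char_coeff A i * (A ^\<^sub>m i) $$ (r, k)) = 0"
    by (simp add: h.hom_sum h.hom_mult)
  then show "(\<Sum>i\<le>n. sym_char_coeff A i * (A ^\<^sub>m i) $$ (r, k)) \<in> comm_ideal"
    by (simp only: abs_ab_hom(2)[OF one])
  have "?h (\<Sum>i\<le>n. (A ^\<^sub>m i) $$ (r, k) * sym_char_coeff A i) = 0"
    using zero by (simp add: h.hom_sum h.hom_mult mult.commute)
  then show "(\<Sum>i\<le>n. (A ^\<^sub>m i) $$ (r, k) * sym_char_coeff A i) \<in> comm_ideal"
    by (simp only: abs_ab_hom(2)[OF one])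
qed

text \<open>The sum factors as \<open>(\<Sum>i. A ^ i \<lambda>_i) (\<Sum>j. \<lambda>_j A ^ j)\<close>. All entries of both factors lie in the
  commutator ideal, whose square is zero.\<close>

lemma cayley_hamilton_two_sided:
  fixes A :: "'a::ring_1 mat"
  assumes n: "0 < n" and id: "\<And>x y u v :: 'a. (x * y - y * x) * (u * v - v * u) = 0"
    and A: "A \<in> carrier_mat n n"
  shows "mat n n (\<lambda>rs. \<Sum>i\<le>n. \<Sum>j\<le>n.
      (A ^\<^sub>m i * (sym_char_coeff2 A i j \<cdot>\<^sub>m 1\<^sub>m n) * A ^\<^sub>m j) $$ rs) = 0\<^sub>m n n"
proof (rule eq_matI)
  fix r s assume "r < dim_row (0\<^sub>m n n :: 'a mat)" "s < dim_col (0\<^sub>m n n :: 'a mat)"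
  then have rs: "r < n" "s < n" by simp_all
  let ?l = "sym_char_coeff A"
  \<comment> \<open>Otherwise \<open>1 = 1 * 1\<close> would be a product of two elements of an ideal of square zero.\<close>
  have one: "1 \<notin> (comm_ideal :: 'a set)"
    using comm_ideal_square_zero[OF id, of 1 1] by auto
  have dim: "dim_row (A ^\<^sub>m i) = n" "dim_col (A ^\<^sub>m i) = n" for i
    using A pow_carrier_mat[OF A, of i] by auto
  have entry: "(A ^\<^sub>m i * (sym_char_coeff2 A i j \<cdot>\<^sub>m 1\<^sub>m n) * A ^\<^sub>m j) $$ (r, s)
      = (\<Sum>k<n. (A ^\<^sub>m i) $$ (r, k) * ?l i * (?l j * (A ^\<^sub>m j) $$ (k, s)))" for i j
    using rs dim
    by (auto simp: scalar_prod_def lessThan_atLeast0 sym_char_coeff2_def mult.assoc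
        if_distrib[of "\<lambda>x. _ * x"] cong: if_cong intro!: sum.cong)
  have "(\<Sum>i\<le>n. \<Sum>j\<le>n. (A ^\<^sub>m i * (sym_char_coeff2 A i j \<cdot>\<^sub>m 1\<^sub>m n) * A ^\<^sub>m j) $$ (r, s))
      = (\<Sum>i\<le>n. \<Sum>k<n. \<Sum>j\<le>n. (A ^\<^sub>m i) $$ (r, k) * ?l i * (?l j * (A ^\<^sub>m j) $$ (k, s)))"
    unfolding entry by (intro sum.cong refl sum.swap)
  also have "\<dots> = (\<Sum>k<n. \<Sum>i\<le>n. \<Sum>j\<le>n. (A ^\<^sub>m i) $$ (r, k) * ?l i * (?l j * (A ^\<^sub>m j) $$ (k, s)))"
    by (rule sum.swap)
  also have "\<dots> = (\<Sum>k<n. (\<Sum>i\<le>n. (A ^\<^sub>m i) $$ (r, k) * ?l i) * (\<Sum>j\<le>n. ?l j * (A ^\<^sub>m j) $$ (k, s)))"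
    by (simp only: sum_product)
  also have "\<dots> = 0"
    using rs by (intro sum.neutral ballI comm_ideal_square_zero[OF id]
        sym_char_poly_mod_comm_ideal[OF one n A]) simp_all
  finally show "mat n n (\<lambda>rs. \<Sum>i\<le>n. \<Sum>j\<le>n.
      (A ^\<^sub>m i * (sym_char_coeff2 A i j \<cdot>\<^sub>m 1\<^sub>m n) * A ^\<^sub>m j) $$ rs) $$ (r, s) = 0\<^sub>m n n $$ (r, s)"
    using rs by simp
qed simp_all

theorem theorem3p1:
  fixes n :: nat and A :: "'a::ring_1 mat"
  assumes "n \<ge> 1"
    and "\<forall>x y u v :: 'a. (x * y - y * x) * (u * v - v * u) = 0"
    and "A \<in> carrier_mat n n"
  shows "sym_char_poly A = (\<Sum>i\<le>n. poly_C (sym_char_coeff A i) * poly_X ^ i) \<and>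
    sym_char_coeff A n = of_nat (fact n) \<and>
    mat n n (\<lambda>rs. \<Sum>i\<le>n. \<Sum>j\<le>n.
      (A ^\<^sub>m i * (sym_char_coeff2 A i j \<cdot>\<^sub>m 1\<^sub>m n) * A ^\<^sub>m j) $$ rs) = 0\<^sub>m n n \<and>
    (\<forall>T \<in> GL_mat n ring_centre. \<forall>S \<in> carrier_mat n n.
      inverts_mat T S \<and> inverts_mat S T \<longrightarrow>
      (\<forall>i\<le>n. \<forall>j\<le>n. sym_char_coeff2 (T * A * S) i j = sym_char_coeff2 A i j))"
proof (intro conjI ballI impI allI)
  have n: "0 < n" using assms(1) by simp
  note A = assms(3)
  show "sym_char_poly A = (\<Sum>i\<le>n. poly_C (sym_char_coeff A i) * poly_X ^ i)"
    by (rule sym_char_poly_expansion[OF n A])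
  show "sym_char_coeff A n = of_nat (fact n)"
    by (rule sym_char_coeff_top(2)[OF n A])
  show "mat n n (\<lambda>rs. \<Sum>i\<le>n. \<Sum>j\<le>n.
      (A ^\<^sub>m i * (sym_char_coeff2 A i j \<cdot>\<^sub>m 1\<^sub>m n) * A ^\<^sub>m j) $$ rs) = 0\<^sub>m n n"
    using assms(2) by (intro cayley_hamilton_two_sided[OF n _ A]) blast
  fix T S i j
  assume "T \<in> GL_mat n (ring_centre :: 'a set)" and S: "S \<in> carrier_mat n n"
    and inv: "inverts_mat T S \<and> inverts_mat S T"
  then obtain S' where T: "T \<in> carrier_mat n n" "elements_mat T \<subseteq> ring_centre"
    and S': "S' \<in> carrier_mat n n" "elements_mat S' \<subseteq> ring_centre" "inverts_mat T S'"
    by (auto simp: GL_mat_def)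
  \<comment> \<open>S is not assumed to have central entries, but T has an inverse \<open>S'\<close> that does, and
    inverses are unique.\<close>
  have "S * (T * S') = S * T * S'"
    using assoc_mult_mat[OF S T(1) S'(1)] by simp
  with inv S S' T have "S = S'"
    by (simp add: inverts_mat_def)
  moreover have "T * S = 1\<^sub>m n"
    using inv T by (simp add: inverts_mat_def)
  ultimately have "sym_char_poly (T * A * S) = sym_char_poly A"
    using S' T S by (intro sym_char_poly_conjugate[OF n A]) simp_all
  then show "sym_char_coeff2 (T * A * S) i j = sym_char_coeff2 A i j"
    by (simp add: sym_char_coeff2_def sym_char_coeff_def)
qed

end
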